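(* Let $G_1,\dots,G_n$ be perfect groups, let $S\le G_1\times\dots\times G_n$ be a subdirect product of $G_1,\dots,G_n$, and let $N\unlhd S$ be a normal subgroup of $S$. If $S/N$ is solvable, then $S/N$ is nilpotent of class at most $n-1$.
   Context: A subgroup $S$ of a direct product $G_1\times\dots\times G_n$ is called subdirect (a subdirect product of $G_1,\dots,G_n$) if its projection to each factor $G_i$ is surjective. A group $G$ is perfect if $[G,G]=G$. Groups are not assumed finite; $n$ is a positive integer. *)

theory Defs
  imports "HOL-Algebra.Product_Groups" "HOL-Algebra.Solvable_Groups"
begin

definition perfect_group :: "('a, 'b) monoid_scheme \<Rightarrow> bool" where
  "perfect_group G \<longleftrightarrow> group G \<and> derived G (carrier G) = carrier G"

definition subdirect_product ::
    "'i set \<Rightarrow> ('i \<Rightarrow> ('a, 'b) monoid_scheme) \<Rightarrow> ('i \<Rightarrow> 'a) set \<Rightarrow> bool" where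
  "subdirect_product I G S \<longleftrightarrow>
     subgroup S (product_group I G) \<and> (\<forall>i\<in>I. (\<lambda>x. x i) ` S = carrier (G i))"

definition mutual_commutator :: "('a, 'b) monoid_scheme \<Rightarrow> 'a set \<Rightarrow> 'a set \<Rightarrow> 'a set" where
  "mutual_commutator G H K =
     generate G (\<Union>h\<in>H. \<Union>k\<in>K. {h \<otimes>\<^bsub>G\<^esub> k \<otimes>\<^bsub>G\<^esub> inv\<^bsub>G\<^esub> h \<otimes>\<^bsub>G\<^esub> inv\<^bsub>G\<^esub> k})"

lemma mutual_commutator_same: "mutual_commutator G H H = derived G H"
  by (simp add: mutual_commutator_def derived_def)

text \<open>
  The series is indexed from 0: \<open>lower_central G k\<close> is the term usually written
  \<open>\<gamma>\<close> with index \<open>k + 1\<close>. A group is thus nilpotent of class at most \<open>c\<close> when the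
  term with index \<open>c\<close> is trivial; the class of the trivial group is 0.
\<close>

primrec lower_central :: "('a, 'b) monoid_scheme \<Rightarrow> nat \<Rightarrow> 'a set" where
  "lower_central G 0 = carrier G"
| "lower_central G (Suc k) = mutual_commutator G (lower_central G k) (carrier G)"

definition nilpotent_group :: "('a, 'b) monoid_scheme \<Rightarrow> bool" where
  "nilpotent_group G \<longleftrightarrow> group G \<and> (\<exists>c. lower_central G c = {\<one>\<^bsub>G\<^esub>})"

text \<open>Meaningful only for nilpotent groups.\<close>

definition nilpotency_class :: "('a, 'b) monoid_scheme \<Rightarrow> nat" where
  "nilpotency_class G = (LEAST c. lower_central G c = {\<one>\<^bsub>G\<^esub>})"

end

theory Submission
  imports Defs
begin

text \<open>
  Let \<open>K i\<close> be the kernel of the projection of \<open>S\<close> to \<open>G (i + 1)\<close>, for \<open>i < n\<close>. Since \<open>G (i + 1)\<close> is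
  perfect, every term of the derived series of \<open>S\<close> projects onto it; one of these terms lies in
  \<open>N\<close>, so \<open>S = K i N\<close> and \<open>K i\<close> maps onto \<open>S/N\<close>. Hence an \<open>n\<close>-fold commutator in \<open>S/N\<close> lifts to a
  commutator of elements taken from \<open>K 0, \<dots>, K (n - 1)\<close>, and this one lies in the intersection of
  the \<open>K i\<close>, which is trivial.
\<close>

text \<open>A commutator is \<open>a\<close> times a conjugate of \<open>inv a\<close>, and also a
  conjugate of \<open>b\<close> times \<open>inv b\<close>. Normality therefore needs only one entry
  in \<open>H\<close>.\<close>

lemma (in normal) commutator_in_left:
  assumes "a \<in> H" "b \<in> carrier G"
  shows "a \<otimes> b \<otimes> inv a \<otimes> inv b \<in> H"
proof -
  have "a \<otimes> (b \<otimes> inv a \<otimes> inv b) \<in> H"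
    using assms inv_op_closed2[of b "inv a"] by (simp add: m_assoc)
  then show ?thesis
    using assms by (simp add: m_assoc)
qed

lemma (in normal) commutator_in_right:
  assumes "a \<in> carrier G" "b \<in> H"
  shows "a \<otimes> b \<otimes> inv a \<otimes> inv b \<in> H"
  using assms inv_op_closed2[of a b] by simp

lemma one_in_lower_central: "group G \<Longrightarrow> \<one>\<^bsub>G\<^esub> \<in> lower_central G k"
  by (cases k) (simp_all add: mutual_commutator_def generate.one group.is_monoid monoid.one_closed)

lemma (in group) exp_of_derived_perfect:
  assumes "perfect_group G"
  shows "(derived G ^^ m) (carrier G) = carrier G"
  using assms by (induction m) (auto simp: perfect_group_def)

text \<open>Homomorphisms carry derived series to derived series, so a term \<open>D\<close> of the
  derived series of \<open>G\<close> that dies in the solvable \<open>Q\<close> still maps onto the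
  perfect \<open>H\<close>.\<close>

lemma image_kernel_perfect_solvable:
  assumes "group_hom G H f" "f ` carrier G = carrier H" "perfect_group H"
    and "group_hom G Q p" "p ` carrier G = carrier Q" "solvable Q"
  shows "p ` kernel G H f = carrier Q"
proof -
  interpret f: group_hom G H f by fact
  interpret p: group_hom G Q p by fact
  obtain m where m: "(derived Q ^^ m) (carrier Q) = {\<one>\<^bsub>Q\<^esub>}"
    using assms(6) p.H.solvable_iff_trivial_derived_seq by blast
  define D where "D = (derived G ^^ m) (carrier G)"
  have D: "D \<subseteq> carrier G"
    unfolding D_def by (simp add: f.G.exp_of_derived_in_carrier)
  have fD: "f ` D = carrier H"
    using f.exp_of_derived_img[of "carrier G" m] assms(2,3) f.H.exp_of_derived_perfect
    by (simp add: D_def)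
  have pD: "p ` D = {\<one>\<^bsub>Q\<^esub>}"
    using p.exp_of_derived_img[of "carrier G" m] assms(5) m by (simp add: D_def)
  have "p s \<in> p ` kernel G H f" if s: "s \<in> carrier G" for s
  proof -
    \<comment> \<open>Dividing \<open>s\<close> by an element of \<open>D\<close> with the same
      image under \<open>f\<close> lands in the kernel and leaves \<open>p s\<close>
      unchanged.\<close>
    obtain t where t: "t \<in> D" "f t = f s"
      using fD s f.hom_closed by (metis imageE)
    have tc: "t \<in> carrier G" using t D by auto
    have "p t = \<one>\<^bsub>Q\<^esub>" using pD t by blast
    then have "p (s \<otimes>\<^bsub>G\<^esub> inv\<^bsub>G\<^esub> t) = p s" using s tc by simp
    moreover have "s \<otimes>\<^bsub>G\<^esub> inv\<^bsub>G\<^esub> t \<in> kernel G H f"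
      using s tc t by (simp add: kernel_def)
    ultimately show ?thesis by (metis imageI)
  qed
  then have "carrier Q \<subseteq> p ` kernel G H f"
    unfolding assms(5)[symmetric] by (rule image_subsetI)
  then show ?thesis
    by (auto simp: kernel_def)
qed

text \<open>Each further entry of an iterated commutator is lifted through one new
  \<open>K i\<close>, the first through \<open>K 0\<close>. The commutator of the lifts stays in
  every earlier \<open>K i\<close> because of its left entry and lies in the new one because of its
  right entry.\<close>

lemma (in group_hom) lower_central_subset_image:
  assumes "\<And>i. i \<le> k \<Longrightarrow> K i \<lhd> G" "\<And>i. i \<le> k \<Longrightarrow> h ` K i = carrier H"
  shows "lower_central H k \<subseteq> h ` (\<Inter>i\<le>k. K i)"
  using assms
proof (induction k)
  case 0
  then show ?case by simp
next
  case (Suc k)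
  have sub: "subgroup (K i) G" if "i \<le> Suc k" for i
    using Suc.prems(1)[OF that] by (simp add: normal_imp_subgroup)
  \<comment> \<open>Once the image is known to be a subgroup, only the generating commutators of the
    next term have to be found in it.\<close>
  then have "subgroup (\<Inter>i\<le>Suc k. K i) G"
    by (intro G.subgroups_Inter) auto
  then have "subgroup (h ` (\<Inter>i\<le>Suc k. K i)) H"
    by (rule subgroup_img_is_subgroup)
  moreover have "a \<otimes>\<^bsub>H\<^esub> b \<otimes>\<^bsub>H\<^esub> inv\<^bsub>H\<^esub> a \<otimes>\<^bsub>H\<^esub> inv\<^bsub>H\<^esub> b \<in> h ` (\<Inter>i\<le>Suc k. K i)"
    if a: "a \<in> lower_central H k" and b: "b \<in> carrier H" for a b
  proof -
    obtain x where x: "x \<in> (\<Inter>i\<le>k. K i)" "a = h x"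
      using Suc a by (meson imageE le_SucI subsetD)
    obtain y where y: "y \<in> K (Suc k)" "b = h y"
      using Suc.prems(2) b by (metis imageE order_refl)
    have xc: "x \<in> carrier G"
      using x(1) subgroup.subset[OF sub[of 0]] by blast
    have yc: "y \<in> carrier G"
      using y(1) subgroup.subset[OF sub[of "Suc k"]] by blast
    have "x \<otimes> y \<otimes> inv x \<otimes> inv y \<in> K i" if "i \<le> Suc k" for i
    proof (cases "i = Suc k")
      case True
      then show ?thesis
        using normal.commutator_in_right[OF Suc.prems(1)[OF that] xc] y by simp
    next
      case False
      then show ?thesis
        using normal.commutator_in_left[OF Suc.prems(1)[OF that] _ yc] x that by simp
    qed
    moreover have "a \<otimes>\<^bsub>H\<^esub> b \<otimes>\<^bsub>H\<^esub> inv\<^bsub>H\<^esub> a \<otimes>\<^bsub>H\<^esub> inv\<^bsub>H\<^esub> b = h (x \<otimes> y \<otimes> inv x \<otimes> inv y)"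
      using x y xc yc by simp
    ultimately show ?thesis by blast
  qed
  ultimately show ?case
    unfolding mutual_commutator_def lower_central.simps
    by (intro H.generate_subgroup_incl) blast+
qed

theorem corollary2p3:
  fixes n :: nat
    and G :: "nat \<Rightarrow> ('a, 'b) monoid_scheme"
    and S N :: "(nat \<Rightarrow> 'a) set"
  assumes "n \<ge> 1"
    and "\<And>i. i \<in> {1..n} \<Longrightarrow> perfect_group (G i)"
    and "subdirect_product {1..n} G S"
    and "N \<lhd> ((product_group {1..n} G)\<lparr>carrier := S\<rparr>)"
    and "solvable (((product_group {1..n} G)\<lparr>carrier := S\<rparr>) Mod N)"
  shows "nilpotent_group (((product_group {1..n} G)\<lparr>carrier := S\<rparr>) Mod N) \<and>
         nilpotency_class (((product_group {1..n} G)\<lparr>carrier := S\<rparr>) Mod N) \<le> n - 1"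
proof -
  define T where "T = (product_group {1..n} G)\<lparr>carrier := S\<rparr>"
  define Q where "Q = T Mod N"
  define p where "p = (#>\<^bsub>T\<^esub>) N"
  \<comment> \<open>The shift matches the factors, numbered from 1, to the family indexed from 0 in
    \<open>lower_central_subset_image\<close>.\<close>
  define K where "K i = kernel T (G (Suc i)) (\<lambda>x. x (Suc i))" for i
  have G: "group (G i)" if "i \<in> {1..n}" for i
    using assms(2)[OF that] by (simp add: perfect_group_def)
  have S: "subgroup S (product_group {1..n} G)"
    using assms(3) by (simp add: subdirect_product_def)
  interpret T: group T
    unfolding T_def by (rule group.subgroup_imp_group[OF product_group[OF G] S])
  interpret N: normal N T
    using assms(4) by (simp add: T_def)
  interpret Q: group Q
    unfolding Q_def by (rule N.factorgroup_is_group)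
  have "p \<in> hom T Q"
    unfolding p_def Q_def by (rule N.r_coset_hom_Mod)
  then interpret p: group_hom T Q p
    by (simp add: group_hom_def group_hom_axioms_def T.group_axioms Q.group_axioms)
  have S_PiE: "S \<subseteq> (\<Pi>\<^sub>E i\<in>{1..n}. carrier (G i))"
    using subgroup.subset[OF S] by simp
  have proj: "group_hom T (G i) (\<lambda>x. x i)" if i: "i \<in> {1..n}" for i
  proof -
    have "(\<lambda>x. x i) \<in> hom T (G i)"
      using PiE_mem[OF subsetD[OF S_PiE] i] i by (intro homI) (simp_all add: T_def)
    then show ?thesis
      using G[OF i] by (simp add: group_hom_def group_hom_axioms_def T.group_axioms)
  qed
  have p_surj: "p ` carrier T = carrier Q"
    by (auto simp: p_def Q_def FactGroup_def RCOSETS_def)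
  have image_K: "p ` K i = carrier Q" if "i \<le> n - 1" for i
  proof -
    \<comment> \<open>Subtraction truncates at 0; \<open>n \<ge> 1\<close> is what turns
      \<open>i \<le> n - 1\<close> into \<open>Suc i \<le> n\<close>.\<close>
    have i: "Suc i \<in> {1..n}" using that assms(1) by auto
    then have "(\<lambda>x. x (Suc i)) ` carrier T = carrier (G (Suc i))"
      using assms(3) by (simp add: subdirect_product_def T_def)
    then show ?thesis
      unfolding K_def
      using image_kernel_perfect_solvable[OF proj[OF i] _ assms(2)[OF i] p.group_hom_axioms p_surj]
        assms(5) by (simp add: Q_def T_def)
  qed
  have normal_K: "K i \<lhd> T" if "i \<le> n - 1" for i
    unfolding K_def by (rule group_hom.normal_kernel[OF proj]) (use that assms(1) in auto)
  have "(\<Inter>i\<le>n - 1. K i) \<subseteq> {\<one>\<^bsub>T\<^esub>}"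
  proof
    fix x assume x: "x \<in> (\<Inter>i\<le>n - 1. K i)"
    \<comment> \<open>One kernel is enough to recover \<open>x \<in> S\<close>. Elements of
      \<open>S\<close> are \<open>undefined\<close> outside \<open>{1..n}\<close>, so their
      coordinates on \<open>{1..n}\<close> determine them.\<close>
    then have "x \<in> K 0" by blast
    then have "x \<in> S" by (simp add: K_def kernel_def T_def)
    then have "x \<in> extensional {1..n}" using S_PiE by (auto simp: PiE_def)
    moreover have "x i = \<one>\<^bsub>G i\<^esub>" if "i \<in> {1..n}" for i
    proof -
      have "i - 1 \<le> n - 1" "Suc (i - 1) = i" using that by auto
      then have "x \<in> K (i - 1)" using x by blast
      then show ?thesis using \<open>Suc (i - 1) = i\<close> by (simp add: K_def kernel_def)
    qed
    ultimately have "x = (\<lambda>i\<in>{1..n}. \<one>\<^bsub>G i\<^esub>)"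
      by (intro extensionalityI[of _ "{1..n}"]) simp_all
    then show "x \<in> {\<one>\<^bsub>T\<^esub>}"
      by (simp add: T_def)
  qed
  \<comment> \<open>Counted from 1 this is the \<open>n\<close>-th term of the series, so its
    commutators use exactly the \<open>n\<close> kernels \<open>K 0\<close> to
    \<open>K (n - 1)\<close>.\<close>
  moreover have "lower_central Q (n - 1) \<subseteq> p ` (\<Inter>i\<le>n - 1. K i)"
    by (rule p.lower_central_subset_image) (use normal_K image_K in auto)
  ultimately have "lower_central Q (n - 1) \<subseteq> {\<one>\<^bsub>Q\<^esub>}"
    using p.hom_one by blast
  then have "lower_central Q (n - 1) = {\<one>\<^bsub>Q\<^esub>}"
    using one_in_lower_central[OF Q.group_axioms] by blast
  then have "nilpotent_group Q \<and> nilpotency_class Q \<le> n - 1"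
    using Q.group_axioms unfolding nilpotent_group_def nilpotency_class_def
    by (blast intro: Least_le)
  then show ?thesis
    by (simp add: Q_def T_def)
qed

end
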